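(* Let $n>k$ be natural numbers such that the remainder of the division of $n$ by $k$ is at least $2k/3$. Then every graph $G$ on $n$ vertices satisfies $h_k(G)\geqslant f_0(n,k)$.
   Context: All graphs are finite, undirected, without loops or multiple edges. For a graph $G$ and a natural number $k$, $h_k(G)$ denotes the number of unordered pairs of distinct vertices of $G$ whose degrees differ by less than $k$. For natural numbers $n>k$, $$f_0(n,k):=\left(\left\lceil \tfrac{n}{k} \right\rceil - 2\right)\binom{k}{2} + \binom{k+1}{2} + \binom{n-k \left( \left\lceil\frac{n}{k} \right\rceil - 1 \right)-1}{2},$$ where $\binom{m}{2}=m(m-1)/2$. *)

theory Defs
  imports Complex_Main "Graph_Theory.Digraph"
begin

text \<open>
  A finite simple undirected graph is a value \<open>G\<close> with \<open>graph G\<close>, i.e. a finite symmetric digraph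
  without loops and multiple arcs: each edge is represented by its two opposite arcs. Hence
  the degree of a vertex is its out-degree.
\<close>

abbreviation degree :: "('a, 'b) pre_digraph \<Rightarrow> 'a \<Rightarrow> nat" where
  "degree G v \<equiv> out_degree G v"

definition close_pairs :: "nat \<Rightarrow> ('a, 'b) pre_digraph \<Rightarrow> 'a set set" where
  "close_pairs k G = {{u, v} | u v. u \<in> verts G \<and> v \<in> verts G \<and> u \<noteq> v \<and>
     \<bar>int (degree G u) - int (degree G v)\<bar> < int k}"

definition h :: "nat \<Rightarrow> ('a, 'b) pre_digraph \<Rightarrow> nat" where
  "h k G = card (close_pairs k G)"

text \<open>
  For \<open>0 < k < n\<close> the ceiling \<open>c\<close> satisfies \<open>2 \<le> c\<close> and \<open>k * (c - 1) < n\<close>, so none of the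
  subtractions on natural numbers below truncates.
\<close>

definition f0 :: "nat \<Rightarrow> nat \<Rightarrow> nat" where
  "f0 n k = (let c = nat \<lceil>real n / real k\<rceil> in
     (c - 2) * (k choose 2) + ((k + 1) choose 2) + ((n - k * (c - 1) - 1) choose 2))"

end

theory Submission
  imports Defs
begin

text \<open>
  Write \<open>n = q k + r\<close> with \<open>r > 0\<close>, put \<open>m = r - 1\<close>, and sort the vertices by degree. Call two
  vertices close if their degrees differ by less than \<open>k\<close>, far otherwise. As degrees are less
  than \<open>n\<close>, there are at most \<open>q + 1\<close> mutually far vertices. Counting the edges at the \<open>r\<close> top and
  the \<open>r\<close> bottom vertices shows that the \<open>r\<close>-th largest and the \<open>r\<close>-th smallest degree differ by less than
  \<open>q k\<close>; hence without the \<open>m\<close> top and the \<open>m\<close> bottom vertices there are at most \<open>q\<close> mutually far ones.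

  Cut the sorted sequence greedily from the bottom into \<open>q + 1\<close> intervals of mutually close vertices.
  If the first or the last one has at most \<open>m\<close> vertices, convexity of \<open>y (y - 1)\<close> gives the bound.
  Otherwise the bottom \<open>m\<close> and the top \<open>m\<close> vertices are mutually close; removing them leaves
  layers of sizes \<open>v 0, \<dots>, v q\<close>, where layer \<open>0\<close> is close to the bottom and layer \<open>q\<close> to the top.
  If layers \<open>0\<close> and \<open>q\<close> together with one of the removed sets formed a single clique, convexity would give
  exactly the bound. What is missing are the \<open>v 0 * v q\<close> pairs between these two layers.
  They are compensated by close pairs between consecutive layers: no far chain
  meets all \<open>q + 1\<close> layers, which forces at least \<open>min (v j * v (j + 1))\<close> such pairs. If this minimum is
  smaller than \<open>v 0 * v q\<close>, then the layer sizes are so unbalanced that the surplus of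
  the sum of squares makes up for the difference.
\<close>

subsection \<open>Inequalities for layer sizes\<close>

text \<open>
  Think of layers of sizes \<open>v 0, \<dots>, v q\<close> and let \<open>a j\<close> be the number of vertices of layer \<open>j\<close>
  that can be reached from layer \<open>0\<close> along far pairs. Reached vertices of layer \<open>j\<close> are close to
  unreached ones of layer \<open>j + 1\<close>, so if no far path crosses all layers (\<open>a q = 0\<close>), then the sum
  below counts close pairs; it is at least the smallest product \<open>v j * v (j + 1)\<close>.
\<close>

lemma layered_paths:
  fixes v a :: "nat \<Rightarrow> int"
  assumes a: "\<And>j. j \<le> q \<Longrightarrow> 0 \<le> a j \<and> a j \<le> v j" and a0: "a 0 = v 0"
    and M: "\<And>j. j < q \<Longrightarrow> M \<le> 2 * (v j * v (Suc j))"
  shows "j \<le> q \<Longrightarrow> M * (v j - a j) \<le> 2 * v j * (\<Sum>i<j. a i * (v (Suc i) - a (Suc i)))"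
proof (induction j)
  case 0
  then show ?case by (simp add: a0)
next
  case (Suc j)
  define X where "X = (\<Sum>i<j. a i * (v (Suc i) - a (Suc i)))"
  define b where "b = v (Suc j) - a (Suc j)"
  have aj: "0 \<le> a j" "a j \<le> v j" and v': "0 \<le> v (Suc j)" and b: "0 \<le> b"
    using a[of j] a[of "Suc j"] Suc.prems by (auto simp: b_def)
  have X: "0 \<le> X"
    unfolding X_def using a Suc.prems by (intro sum_nonneg mult_nonneg_nonneg) auto
  have IH: "M * (v j - a j) \<le> 2 * v j * X"
    using Suc by (simp add: X_def)
  have Mj: "M \<le> 2 * (v j * v (Suc j))"
    using M Suc.prems by simp
  have "M * b \<le> 2 * v (Suc j) * (X + a j * b)"
  proof (cases "M \<le> 0")
    case True
    then have "M * b \<le> 0" using b by (simp add: mult_nonpos_nonneg)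
    also have "0 \<le> 2 * v (Suc j) * (X + a j * b)" using v' X aj b by simp
    finally show ?thesis .
  next
    case False
    have vj: "v j > 0"
      using False Mj aj by (cases "v j = 0") auto
    have b_le: "b \<le> v (Suc j)" using a[of "Suc j"] Suc.prems by (simp add: b_def)
    \<comment> \<open>The factor \<open>v j\<close> lets the induction hypothesis bound the first
      summand and the assumption on \<open>M\<close> the second.\<close>
    have "v j * (M * b) = M * (v j - a j) * b + a j * b * M"
      by (simp add: algebra_simps)
    also have "\<dots> \<le> M * (v j - a j) * v (Suc j) + a j * b * (2 * (v j * v (Suc j)))"
      using False aj b b_le Mj by (intro add_mono mult_left_mono) auto
    also have "\<dots> \<le> 2 * v j * X * v (Suc j) + a j * b * (2 * (v j * v (Suc j)))"
      using IH v' by (intro add_mono mult_right_mono order_refl)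
    also have "\<dots> = v j * (2 * v (Suc j) * (X + a j * b))"
      by (simp add: algebra_simps)
    finally show ?thesis using vj by (simp only: mult_le_cancel_left_pos)
  qed
  then show ?case by (simp add: X_def b_def)
qed

lemma layered_path_cut:
  fixes v a :: "nat \<Rightarrow> int"
  assumes a: "\<And>j. j \<le> q \<Longrightarrow> 0 \<le> a j \<and> a j \<le> v j" and a0: "a 0 = v 0" and aq: "a q = 0"
    and q: "0 < q" and M: "\<And>j. j < q \<Longrightarrow> M \<le> 2 * (v j * v (Suc j))"
  shows "M \<le> 2 * (\<Sum>i<q. a i * (v (Suc i) - a (Suc i)))"
proof -
  define X where "X = (\<Sum>i<q. a i * (v (Suc i) - a (Suc i)))"
  have X: "0 \<le> X"
    unfolding X_def using a by (intro sum_nonneg mult_nonneg_nonneg) auto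
  have "M * v q \<le> 2 * v q * X"
    using layered_paths[where q = q and v = v and a = a and M = M and j = q] assms
    by (simp add: X_def)
  then have *: "v q * M \<le> v q * (2 * X)" by (simp add: algebra_simps)
  have vq: "0 \<le> v q" using a[of q] by simp
  have "M \<le> 2 * X"
  proof (cases "v q = 0")
    case True
    then have "M \<le> 0" using M[of "q - 1"] q by simp
    then show ?thesis using X by linarith
  next
    case False
    then show ?thesis using * vq by (simp add: mult_le_cancel_left)
  qed
  then show ?thesis by (simp add: X_def)
qed

text \<open>Here \<open>x\<close> and \<open>y\<close> are the end layers and \<open>z\<close> is
  the neighbour of \<open>x\<close>. With \<open>d\<close> the difference of the squared terms'
  bases, \<open>x * (y - z)\<close> is at most a quarter of \<open>(d - m)\<^sup>2\<close>, while
  the two squares add up to at least half of \<open>d\<^sup>2\<close>.\<close>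

lemma end_product_bound:
  fixes x y z k m :: int
  assumes x: "0 \<le> x" and m: "1 \<le> m"
  shows "2 * (x * y) + 1 \<le> 2 * (x * z) + (x + y + m - k)\<^sup>2 + (z - k)\<^sup>2 \<or> x = 0"
proof -
  define d where "d = (x + y + m - k) - (z - k)"
  have yz: "y - z = d - m - x" by (simp add: d_def)
  have sq: "d\<^sup>2 \<le> 2 * ((x + y + m - k)\<^sup>2 + (z - k)\<^sup>2)"
  proof -
    have "0 \<le> ((x + y + m - k) + (z - k))\<^sup>2" by simp
    then show ?thesis by (simp add: d_def power2_eq_square algebra_simps)
  qed
  have main: "2 * (x * (d - m - x)) + 1 \<le> (x + y + m - k)\<^sup>2 + (z - k)\<^sup>2" if "x \<noteq> 0"
  proof -
    have x1: "1 \<le> x" using x that by simp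
    show ?thesis
    proof (cases "d \<le> m")
      case True
      then have "d - m - x \<le> -1" using x1 by simp
      then have "x * (d - m - x) \<le> x * (-1)" using x by (intro mult_left_mono) auto
      then have "2 * (x * (d - m - x)) + 1 \<le> 0" using x1 by simp
      also have "0 \<le> (x + y + m - k)\<^sup>2 + (z - k)\<^sup>2" by simp
      finally show ?thesis .
    next
      case False
      have "0 \<le> (d - m - 2 * x)\<^sup>2" by simp
      then have 1: "4 * (x * (d - m - x)) \<le> (d - m)\<^sup>2"
        by (simp add: power2_eq_square algebra_simps)
      have "(d - m)\<^sup>2 \<le> (d - 1)\<^sup>2" using False m by (intro power_mono) auto
      also have "(d - 1)\<^sup>2 = d\<^sup>2 - 2 * d + 1" by (simp add: power2_eq_square algebra_simps)
      finally have 2: "(d - m)\<^sup>2 \<le> d\<^sup>2 - 2 * d + 1" .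
      have "2 \<le> d" using False m by simp
      moreover define P Q where "P = x * (d - m - x)" and "Q = (x + y + m - k)\<^sup>2 + (z - k)\<^sup>2"
      ultimately have "2 * P + 1 \<le> Q"
        using 1 2 sq by (simp only: P_def[symmetric] Q_def[symmetric])
      then show ?thesis by (simp add: P_def Q_def)
    qed
  qed
  have eq: "2 * (x * (d - m - x)) = 2 * (x * y) - 2 * (x * z)"
    unfolding yz[symmetric] by (simp add: algebra_simps)
  from main eq show ?thesis by auto
qed

text \<open>The last two squares complete \<open>2 * (u * w)\<close> to
  \<open>(u + w - k)\<^sup>2 + k\<^sup>2\<close>; the left product is bounded by its arithmetic
  mean.\<close>

lemma inner_product_bound:
  fixes x y u w k m :: int
  assumes "1 \<le> m" "m \<le> k"
  shows "2 * (x * y) + 1 \<le> 2 * (u * w) + (x + y + m - k)\<^sup>2 + (u - k)\<^sup>2 + (w - k)\<^sup>2"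
proof -
  define t where "t = x + y + m - k"
  have "0 \<le> (x - y)\<^sup>2" by simp
  then have "4 * (x * y) \<le> (x + y)\<^sup>2" by (simp add: power2_eq_square algebra_simps)
  also have "x + y = t + (k - m)" by (simp add: t_def)
  also have "(t + (k - m))\<^sup>2 \<le> 2 * t\<^sup>2 + 2 * (k - m)\<^sup>2"
    using zero_le_power2[of "t - (k - m)"] by (simp add: power2_eq_square algebra_simps)
  finally have "2 * (x * y) \<le> t\<^sup>2 + (k - m)\<^sup>2" by linarith
  also have "(k - m)\<^sup>2 \<le> (k - 1)\<^sup>2" using assms by (intro power_mono) auto
  also have "(k - 1)\<^sup>2 = k\<^sup>2 - 2 * k + 1" by (simp add: power2_eq_square algebra_simps)
  finally have 1: "2 * (x * y) \<le> t\<^sup>2 + (k\<^sup>2 - 2 * k + 1)" by simp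
  have "2 * (u * w) + (u - k)\<^sup>2 + (w - k)\<^sup>2 = (u + w - k)\<^sup>2 + k\<^sup>2"
    by (simp add: power2_eq_square algebra_simps)
  moreover have "0 \<le> (u + w - k)\<^sup>2" by simp
  moreover have "1 \<le> k" using assms by simp
  ultimately show ?thesis using 1 by (simp only: t_def[symmetric])
qed

text \<open>Layers \<open>0\<close> and \<open>q\<close> with one removed set form a block of size
  \<open>t + k\<close>, which makes \<open>q\<close> blocks with \<open>q * k + 1\<close> elements.
  Their quadratic sum exceeds its minimum by \<open>t\<^sup>2 + S - 1\<close>; this and the cut pay
  for the missing \<open>2 * (v 0 * v q)\<close>.\<close>

lemma layered_count:
  fixes v a :: "nat \<Rightarrow> int" and k m :: int
  assumes a: "\<And>j. j \<le> q \<Longrightarrow> 0 \<le> a j \<and> a j \<le> v j" and a0: "a 0 = v 0" and aq: "a q = 0"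
    and q: "0 < q" and m: "1 \<le> m" "m \<le> k"
    and total: "v 0 + (\<Sum>j\<in>{1..<q}. v j) + v q + m = int q * k + 1"
  shows "int q * k * (k - 1) + 2 * k \<le> m * (m - 1) + 2 * m * (v 0 + v q)
      + v 0 * (v 0 - 1) + (\<Sum>j\<in>{1..<q}. v j * (v j - 1)) + v q * (v q - 1)
      + 2 * (\<Sum>i<q. a i * (v (Suc i) - a (Suc i)))"
proof -
  define t where "t = v 0 + v q + m - k"
  define S where "S = (\<Sum>j\<in>{1..<q}. (v j - k)\<^sup>2)"
  have v: "0 \<le> v j" if "j \<le> q" for j using a[OF that] by simp
  have "int (card {1..<q}) = int q - 1" using q by simp
  then have dev: "t + (\<Sum>j\<in>{1..<q}. v j - k) = 1"
    using total by (simp add: t_def sum_subtractf algebra_simps)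
  have S_ge: "(\<Sum>j\<in>J. (v j - k)\<^sup>2) \<le> S" if "J \<subseteq> {1..<q}" for J
    unfolding S_def using that by (intro sum_mono2) auto
  have int_sq: "x \<le> x\<^sup>2" for x :: int
    by (cases "x \<le> 0") (auto simp: power2_eq_square intro: order_trans[of x 0])
  have D1: "1 \<le> t\<^sup>2 + S"
  proof -
    have "(\<Sum>j\<in>{1..<q}. v j - k) \<le> S" unfolding S_def by (intro sum_mono int_sq)
    with int_sq[of t] dev show ?thesis by linarith
  qed
  have cut: "2 * (v 0 * v q) + 1 - (t\<^sup>2 + S) \<le> 2 * (\<Sum>i<q. a i * (v (Suc i) - a (Suc i)))"
  proof (rule layered_path_cut[OF a a0 aq q])
    fix j assume j: "j < q"
    \<comment> \<open>For \<open>q = 1\<close> the only product is \<open>v 0 * v q\<close> itself.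
      If an end layer is empty, \<open>D1\<close> suffices.\<close>
    consider "j = 0" "Suc j = q" | "j = 0" "Suc j < q" | "0 < j" "Suc j = q" | "0 < j" "Suc j < q"
      using j by linarith
    then show "2 * (v 0 * v q) + 1 - (t\<^sup>2 + S) \<le> 2 * (v j * v (Suc j))"
    proof cases
      case 1
      then show ?thesis using D1 by simp
    next
      case 2
      have "(v 1 - k)\<^sup>2 \<le> S" using S_ge[of "{1}"] 2 by simp
      with end_product_bound[of "v 0" m "v q" "v 1" k] v[of 0] m 2 D1
      show ?thesis by (auto simp: t_def)
    next
      case 3
      have "(v j - k)\<^sup>2 \<le> S" using S_ge[of "{j}"] 3 by simp
      with end_product_bound[of "v q" m "v 0" "v j" k] v[of q] m 3 D1
      show ?thesis by (auto simp: t_def algebra_simps)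
    next
      case 4
      have "(v j - k)\<^sup>2 + (v (Suc j) - k)\<^sup>2 \<le> S" using S_ge[of "{j, Suc j}"] 4 by simp
      with inner_product_bound[OF m, of "v 0" "v q" "v j" "v (Suc j)"]
      show ?thesis by (simp add: t_def)
    qed
  qed auto
  have "(\<Sum>j\<in>{1..<q}. v j * (v j - 1))
      = (\<Sum>j\<in>{1..<q}. (v j - k)\<^sup>2 + (2 * k - 1) * (v j - k) + k * (k - 1))"
    by (intro sum.cong) (auto simp: power2_eq_square algebra_simps)
  also have "\<dots> = S + (2 * k - 1) * (\<Sum>j\<in>{1..<q}. v j - k) + (int q - 1) * (k * (k - 1))"
    using q by (simp add: S_def sum.distrib sum_distrib_left del: sum_subtractf)
  also have "(\<Sum>j\<in>{1..<q}. v j - k) = 1 - t" using dev by simp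
  finally have inner: "(\<Sum>j\<in>{1..<q}. v j * (v j - 1))
      = S + (2 * k - 1) * (1 - t) + (int q - 1) * (k * (k - 1))" .
  have "m * (m - 1) + 2 * m * (v 0 + v q) + v 0 * (v 0 - 1) + v q * (v q - 1)
      = (t + k) * (t + k - 1) - 2 * (v 0 * v q)"
    by (simp add: t_def algebra_simps)
  also have "(t + k) * (t + k - 1) = t\<^sup>2 + (2 * k - 1) * t + k * (k - 1)"
    by (simp add: power2_eq_square algebra_simps)
  finally have "m * (m - 1) + 2 * m * (v 0 + v q) + v 0 * (v 0 - 1) + v q * (v q - 1)
      + (\<Sum>j\<in>{1..<q}. v j * (v j - 1))
      = t\<^sup>2 + S + (2 * k - 1) + int q * (k * (k - 1)) - 2 * (v 0 * v q)"
    unfolding inner by (simp add: algebra_simps)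
  with cut show ?thesis by (simp add: algebra_simps)
qed

subsection \<open>Close pairs in a monotone sequence\<close>

locale monotone_sequence =
  fixes n k :: nat and d :: "nat \<Rightarrow> nat"
  assumes k_pos: "0 < k" and d_mono: "i \<le> j \<Longrightarrow> j < n \<Longrightarrow> d i \<le> d j"
begin

text \<open>\<open>jump i\<close> is the first index whose value is at least \<open>d i + k\<close>; it is \<open>n\<close> if there is none.\<close>

definition jump :: "nat \<Rightarrow> nat" where
  "jump i = (LEAST j. n \<le> j \<or> i < n \<and> d i + k \<le> d j)"

lemma jump_le: "jump i \<le> n"
  unfolding jump_def by (rule Least_le) simp

lemma jump_far: "jump i < n \<Longrightarrow> i < n \<and> d i + k \<le> d (jump i)"
  using LeastI[of "\<lambda>j. n \<le> j \<or> i < n \<and> d i + k \<le> d j" n] by (auto simp: jump_def)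

lemma close_if_less_jump: "i < n \<Longrightarrow> j < jump i \<Longrightarrow> d j < d i + k"
  unfolding jump_def by (drule not_less_Least) auto

lemma less_jump: "i < n \<Longrightarrow> i < jump i"
  using jump_far[of i] d_mono[of "jump i" i] k_pos
  by (cases "jump i < n") (force simp: not_less)+

lemma jump_mono: "i \<le> j \<Longrightarrow> jump i \<le> jump j"
proof (cases "jump j < n")
  case True
  assume "i \<le> j"
  with jump_far[OF True] d_mono[of i j] show ?thesis
    unfolding jump_def[of i] by (intro Least_le) auto
qed (use jump_le[of i] in auto)

lemma funpow_jump_mono: "i \<le> j \<Longrightarrow> (jump ^^ c) i \<le> (jump ^^ c) j"
  by (induction c) (auto intro: jump_mono)

lemma funpow_jump_le: "i \<le> n \<Longrightarrow> (jump ^^ c) i \<le> n"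
  by (cases c) (auto simp: jump_le)

lemma jump_ge: "i \<le> n \<Longrightarrow> i \<le> jump i"
  using less_jump[of i] jump_mono[of n i] jump_far[of n] jump_le[of n]
  by (cases "i = n") (force simp: le_less)+

lemma funpow_jump_ge: "i \<le> n \<Longrightarrow> i \<le> (jump ^^ c) i"
  by (induction c) (auto intro: order_trans jump_ge funpow_jump_le)

lemma funpow_jump_far: "(jump ^^ c) i < n \<Longrightarrow> d i + c * k \<le> d ((jump ^^ c) i)"
proof (induction c)
  case (Suc c)
  then show ?case using jump_far[of "(jump ^^ c) i"] by simp
qed simp

text \<open>For \<open>u \<le> n\<close> this counts the pairs \<open>i < j\<close> with \<open>l \<le> i < u\<close> and \<open>d j < d i + k\<close>.\<close>

definition pair_weight :: "nat \<Rightarrow> nat \<Rightarrow> int" where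
  "pair_weight l u = (\<Sum>i\<in>{l..<u}. int (jump i) - int i - 1)"

lemma pair_weight_append: "l \<le> u \<Longrightarrow> u \<le> w \<Longrightarrow> pair_weight l w = pair_weight l u + pair_weight u w"
  unfolding pair_weight_def by (simp add: sum.atLeastLessThan_concat)

text \<open>The terms count, twice, the pairs inside \<open>{l..<u}\<close> and those between
  \<open>{l..<u}\<close> and \<open>{u..<z}\<close>. Over the integers the bound survives
  \<open>z < u\<close>.\<close>

lemma pair_weight_ge:
  assumes "l \<le> u" and z: "\<And>i. l \<le> i \<Longrightarrow> i < u \<Longrightarrow> z \<le> jump i"
  shows "(int u - int l) * (int u - int l - 1) + 2 * (int u - int l) * (int z - int u)
    \<le> 2 * pair_weight l u"
  using assms(1) z
proof (induction u rule: dec_induct)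
  case base
  then show ?case by (simp add: pair_weight_def)
next
  case (step u)
  have "z \<le> jump u" using step.hyps step.prems by blast
  moreover have "pair_weight l (Suc u) = pair_weight l u + (int (jump u) - int u - 1)"
    using step by (simp add: pair_weight_def)
  moreover note step.IH[OF step.prems, OF _ less_SucI]
  ultimately show ?case by (simp add: algebra_simps)
qed

lemma pair_weight_clique:
  assumes "i \<le> u" "u \<le> jump i"
  shows "(int u - int i) * (int u - int i - 1) \<le> 2 * pair_weight i u"
  using pair_weight_ge[of i u u] assms jump_mono[of i] by force

text \<open>A tangent to the convex function \<open>y * (y - 1)\<close>, touching it at the integers \<open>k\<close> and \<open>k + 1\<close>.\<close>

lemma clique_chord:
  fixes y :: int shows "2 * int k * y - int k * (int k + 1) \<le> y * (y - 1)"
proof -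
  have "0 \<le> (y - int k) * (y - int k - 1)"
    by (cases "y \<le> int k") (auto intro: mult_nonpos_nonpos)
  then show ?thesis by (simp add: algebra_simps)
qed

text \<open>Each jump spans a clique; the tangent is linear, so the sum depends only on the total
  length and on \<open>c\<close>.\<close>

lemma pair_weight_jumps:
  assumes "i \<le> n"
  shows "2 * int k * (int ((jump ^^ c) i) - int i) - int c * (int k * (int k + 1))
    \<le> 2 * pair_weight i ((jump ^^ c) i)"
proof (induction c)
  case 0
  then show ?case by (simp add: pair_weight_def)
next
  case (Suc c)
  define u where "u = (jump ^^ c) i"
  have u: "u \<le> n" "i \<le> u"
    using funpow_jump_le[OF assms] funpow_jump_ge[OF assms] by (simp_all add: u_def)
  have "2 * int k * (int (jump u) - int u) - int k * (int k + 1) \<le> 2 * pair_weight u (jump u)"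
    using clique_chord[of "int (jump u) - int u"] pair_weight_clique[of u "jump u"] jump_ge[OF u(1)]
    by simp
  moreover have "pair_weight i (jump u) = pair_weight i u + pair_weight u (jump u)"
    using u jump_ge by (intro pair_weight_append) auto
  ultimately show ?case using Suc by (simp add: u_def[symmetric] algebra_simps)
qed

text \<open>A block of \<open>L\<close> indices beside \<open>q\<close> greedy cliques: the left
  side of \<open>w\<close> does not increase with \<open>L\<close> up to \<open>m\<close>, and at
  \<open>L = m\<close> it is the claimed bound.\<close>

lemma pair_weight_small_block:
  assumes n: "n = q * k + m + 1" and m: "m \<le> k" and L: "L \<le> m"
    and w: "2 * int k * (int n - int L) - int q * (int k * (int k + 1)) + int L * (int L - 1)
      \<le> 2 * pair_weight 0 n"
  shows "int q * int k * (int k - 1) + 2 * int k + int m * (int m - 1) \<le> 2 * pair_weight 0 n"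
proof -
  have "(int m - int L) * (int m + int L - 1) \<le> (int m - int L) * (2 * int k)"
    using m L by (intro mult_left_mono) auto
  then show ?thesis using w by (simp add: n algebra_simps)
qed

text \<open>Two greedy chains interleave: the one from \<open>0\<close> cuts the layers, the one
  from \<open>m\<close> marks where their reached parts begin.\<close>

lemma pair_weight_interleaved:
  assumes n: "n = q * k + m + 1" and q: "0 < q" and m: "m \<le> k"
    and long: "(jump ^^ Suc q) 0 = n"
    and middle: "n \<le> (jump ^^ q) m + m"
    and first: "m < jump 0" and last: "(jump ^^ q) 0 + m < n"
  shows "int q * int k * (int k - 1) + 2 * int k + int m * (int m - 1) \<le> 2 * pair_weight 0 n"
proof -
  have m1: "1 \<le> m"
    using middle last by (cases m) auto
  \<comment> \<open>\<open>s 0 \<le> t 0 \<le> s 1 \<le> t 1 \<le> \<dots> \<le> s q \<le> t q = s (q + 1) = n - m\<close>: the layers are \<open>{s j..<s (j + 1)}\<close>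
    and the reached part of layer \<open>j\<close> is \<open>{t j..<s (j + 1)}\<close>.\<close>
  define g where "g j = (jump ^^ j) 0" for j
  define t where "t j = (if j < q then (jump ^^ j) m else n - m)" for j
  define s where "s j = (if j = 0 then m else if j \<le> q then g j else n - m)" for j
  have g_le_t: "g j \<le> t j" if "j \<le> q" for j
  proof (cases "j < q")
    case True
    then show ?thesis using funpow_jump_mono[of 0 m j] by (simp add: g_def t_def)
  next
    case False
    then show ?thesis using that last by (simp add: g_def t_def)
  qed
  have t_le_g: "t j \<le> g (Suc j)" if "j < q" for j
    using funpow_jump_mono[of m "jump 0" j] first that
    by (simp add: g_def t_def funpow_swap1)
  have g_Suc: "g (Suc j) = jump (g j)" for j by (simp add: g_def)
  \<comment> \<open>For \<open>Suc j = q\<close> this is what \<open>middle\<close> provides, as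
    \<open>t q\<close> is set to \<open>n - m\<close>.\<close>
  have t_Suc: "t (Suc j) \<le> jump (t j)" if "j < q" for j
    using that middle by (cases "Suc j = q") (auto simp: t_def)
  have s_le_t: "s j \<le> t j" if "j \<le> q" for j
    using g_le_t[OF that] q by (auto simp: s_def t_def)
  have t_le_s: "t j \<le> s (Suc j)" if "j \<le> q" for j
    using t_le_g[of j] that by (cases "j = q") (auto simp: s_def t_def)
  have s_mono: "s j \<le> s (Suc j)" if "j \<le> q" for j
    using s_le_t t_le_s that order_trans by blast
  define v where "v j = int (s (Suc j)) - int (s j)" for j
  define a where "a j = int (s (Suc j)) - int (t j)" for j
  \<comment> \<open>Indices of layer \<open>j\<close> below \<open>t j\<close> are close up to
    \<open>g (Suc j)\<close>, those from \<open>t j\<close> on even up to \<open>t (Suc j)\<close>,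
    which yields the product.\<close>
  have block: "v j * (v j - 1) + 2 * a j * (v (Suc j) - a (Suc j)) \<le> 2 * pair_weight (s j) (s (Suc j))"
    if j: "j < q" for j
  proof -
    have s_Suc: "s (Suc j) = g (Suc j)" using j by (simp add: s_def)
    have lower: "(int (t j) - int (s j)) * (int (t j) - int (s j) - 1)
        + 2 * (int (t j) - int (s j)) * (int (g (Suc j)) - int (t j)) \<le> 2 * pair_weight (s j) (t j)"
    proof (rule pair_weight_ge)
      fix i assume "s j \<le> i" "i < t j"
      then have "g j \<le> i" using q j by (auto simp: s_def t_def split: if_splits)
      then show "g (Suc j) \<le> jump i" unfolding g_Suc by (rule jump_mono)
    qed (use s_le_t j in auto)
    have upper: "(int (g (Suc j)) - int (t j)) * (int (g (Suc j)) - int (t j) - 1)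
        + 2 * (int (g (Suc j)) - int (t j)) * (int (t (Suc j)) - int (g (Suc j)))
        \<le> 2 * pair_weight (t j) (g (Suc j))"
    proof (rule pair_weight_ge)
      fix i assume "t j \<le> i" "i < g (Suc j)"
      then show "t (Suc j) \<le> jump i" using t_Suc[OF j] jump_mono order_trans by blast
    qed (use t_le_g j in auto)
    have "pair_weight (s j) (g (Suc j)) = pair_weight (s j) (t j) + pair_weight (t j) (g (Suc j))"
      using s_le_t t_le_g j by (intro pair_weight_append) auto
    with lower upper show ?thesis
      by (simp add: v_def a_def s_Suc algebra_simps)
  qed
  have sq: "s q = g q" using q by (simp add: s_def)
  have top: "v q * (v q - 1) + 2 * v q * int m \<le> 2 * pair_weight (s q) (n - m)"
  proof -
    have "(int (n - m) - int (g q)) * (int (n - m) - int (g q) - 1)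
        + 2 * (int (n - m) - int (g q)) * (int n - int (n - m)) \<le> 2 * pair_weight (g q) (n - m)"
    proof (rule pair_weight_ge)
      fix i assume "g q \<le> i" "i < n - m"
      then show "n \<le> jump i" using jump_mono[of "g q" i] long by (simp add: g_def)
    qed (use last g_def in auto)
    then show ?thesis using n by (simp add: v_def s_def sq[unfolded s_def])
  qed
  have bottom: "int m * (int m - 1) + 2 * int m * v 0 \<le> 2 * pair_weight 0 m"
    using pair_weight_ge[of 0 m "jump 0"] jump_mono[of 0] q by (simp add: v_def s_def g_def)
  have ends: "int m * (int m - 1) \<le> 2 * pair_weight (n - m) n"
  proof -
    have "jump (g q) \<le> jump (n - m)" using last by (intro jump_mono) (simp add: g_def)
    then show ?thesis
      using pair_weight_clique[of "n - m" n] long n by (simp add: g_def)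
  qed
  have parts: "pair_weight m (s j) = (\<Sum>i<j. pair_weight (s i) (s (Suc i)))" if "j \<le> q" for j
    using that
  proof (induction j)
    case 0
    then show ?case by (simp add: s_def pair_weight_def)
  next
    case (Suc j)
    have "m \<le> s j"
      using Suc.prems
    proof (induction j)
      case (Suc j)
      then show ?case using s_mono[of j] by auto
    qed (simp add: s_def)
    then have "pair_weight m (s (Suc j)) = pair_weight m (s j) + pair_weight (s j) (s (Suc j))"
      using Suc.prems s_mono[of j] by (intro pair_weight_append) auto
    then show ?case using Suc by simp
  qed
  have m_le: "m \<le> g q"
  proof -
    have "m \<le> jump 0" using first by simp
    also have "jump 0 \<le> (jump ^^ (q - 1)) (jump 0)"
      by (rule funpow_jump_ge[OF jump_le])
    also have "\<dots> = g q" using q by (cases q) (simp_all add: g_def funpow_swap1)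
    finally show ?thesis .
  qed
  have whole: "pair_weight 0 n = pair_weight 0 m + (\<Sum>i<q. pair_weight (s i) (s (Suc i)))
      + pair_weight (s q) (n - m) + pair_weight (n - m) n"
    using pair_weight_append[of 0 m n] pair_weight_append[of m "s q" n]
      pair_weight_append[of "s q" "n - m" n] parts[of q] m_le last sq n
    by (simp add: g_def)
  have telescope: "(\<Sum>i<j. v i) = int (s j) - int m" for j
    by (induction j) (auto simp: v_def s_def)
  have split: "(\<Sum>i<q. f i) = f 0 + (\<Sum>i\<in>{1..<q}. f i)" for f :: "nat \<Rightarrow> int"
    using q by (simp add: lessThan_atLeast0 sum.atLeast_Suc_lessThan)
  have "int q * int k * (int k - 1) + 2 * int k \<le> int m * (int m - 1) + 2 * int m * (v 0 + v q)
      + v 0 * (v 0 - 1) + (\<Sum>j\<in>{1..<q}. v j * (v j - 1)) + v q * (v q - 1)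
      + 2 * (\<Sum>i<q. a i * (v (Suc i) - a (Suc i)))"
  proof (rule layered_count)
    fix j assume "j \<le> q"
    then show "0 \<le> a j \<and> a j \<le> v j" using s_le_t[of j] t_le_s[of j] by (simp add: a_def v_def)
  next
    show "a 0 = v 0" using q by (simp add: a_def v_def s_def t_def)
    show "a q = 0" by (simp add: a_def s_def t_def)
    show "v 0 + (\<Sum>j\<in>{1..<q}. v j) + v q + int m = int q * int k + 1"
      using telescope[of "Suc q"] split[of v] n q by (simp add: s_def)
  qed (use q m m1 in auto)
  moreover have "(\<Sum>i<q. v i * (v i - 1) + 2 * a i * (v (Suc i) - a (Suc i)))
      \<le> (\<Sum>i<q. 2 * pair_weight (s i) (s (Suc i)))"
    by (intro sum_mono block) auto
  then have "(\<Sum>i<q. v i * (v i - 1)) + 2 * (\<Sum>i<q. a i * (v (Suc i) - a (Suc i)))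
      \<le> 2 * (\<Sum>i<q. pair_weight (s i) (s (Suc i)))"
    by (simp add: sum.distrib sum_distrib_left mult.assoc)
  ultimately show ?thesis
    using top bottom ends whole split[of "\<lambda>i. v i * (v i - 1)"] by (simp add: algebra_simps)
qed

lemma pair_weight_bound:
  assumes n: "n = q * k + m + 1" and q: "0 < q" and m: "m \<le> k"
    and long: "(jump ^^ Suc q) 0 = n"
    and middle: "n \<le> (jump ^^ q) m + m"
  shows "int q * int k * (int k - 1) + 2 * int k + int m * (int m - 1) \<le> 2 * pair_weight 0 n"
proof -
  \<comment> \<open>A first or last greedy interval with at most \<open>m\<close> indices serves as
    the block of \<open>pair_weight_small_block\<close>.\<close>
  consider "jump 0 \<le> m" | "n \<le> (jump ^^ q) 0 + m" | "m < jump 0" "(jump ^^ q) 0 + m < n"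
    by linarith
  then show ?thesis
  proof cases
    case 1
    have "pair_weight 0 n = pair_weight 0 (jump 0) + pair_weight (jump 0) n"
      by (intro pair_weight_append jump_le) auto
    moreover have "(jump ^^ q) (jump 0) = n" using long by (simp add: funpow_swap1)
    ultimately show ?thesis
      using pair_weight_jumps[OF jump_le, of q 0] pair_weight_clique[of 0 "jump 0"]
      by (intro pair_weight_small_block[OF n m 1]) simp
  next
    case 2
    define u where "u = (jump ^^ q) 0"
    have u: "u \<le> n" "n - u \<le> m"
      using 2 funpow_jump_le[of 0 q] by (auto simp: u_def)
    have "pair_weight 0 n = pair_weight 0 u + pair_weight u n"
      using u by (intro pair_weight_append) auto
    moreover have "jump u = n" using long by (simp add: u_def)
    ultimately show ?thesis
      using pair_weight_jumps[of 0 q] pair_weight_clique[of u n] u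
      by (intro pair_weight_small_block[OF n m u(2)]) (simp add: u_def)
  next
    case 3
    then show ?thesis using pair_weight_interleaved assms by simp
  qed
qed

end

subsection \<open>Degrees in a graph\<close>

lemma (in digraph) out_degree_eq_card: "out_degree G u = card {w. u \<rightarrow>\<^bsub>G\<^esub> w}"
proof -
  have "bij_betw (head G) (out_arcs G u) {w. u \<rightarrow>\<^bsub>G\<^esub> w}"
    unfolding bij_betw_def
  proof
    show "inj_on (head G) (out_arcs G u)"
      by (auto intro!: inj_onI no_multi_arcs simp: arc_to_ends_def)
    show "head G ` out_arcs G u = {w. u \<rightarrow>\<^bsub>G\<^esub> w}"
      by (force simp: arcs_ends_def arc_to_ends_def)
  qed
  then show ?thesis unfolding out_degree_def by (rule bij_betw_same_card)
qed

lemma (in digraph) out_degree_less: "u \<in> verts G \<Longrightarrow> out_degree G u < card (verts G)"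
proof -
  assume u: "u \<in> verts G"
  have "{w. u \<rightarrow>\<^bsub>G\<^esub> w} \<subset> verts G"
    using u adj_not_same[of u] by (auto dest: adj_in_verts)
  then show ?thesis unfolding out_degree_eq_card by (intro psubset_card_mono finite_verts)
qed

text \<open>A vertex of \<open>T\<close> has at most \<open>card (verts G) - r - 1\<close>
  neighbours outside \<open>B\<close>, and the edges between \<open>T\<close> and \<open>B\<close>
  are covered by the degrees in \<open>B\<close>.\<close>

lemma (in graph) sum_out_degree_gap:
  assumes T: "T \<subseteq> verts G" "card T = r" and B: "B \<subseteq> verts G" "card B = r" and "T \<inter> B = {}"
  shows "(\<Sum>u\<in>T. out_degree G u) \<le> (\<Sum>w\<in>B. out_degree G w) + r * (card (verts G) - r - 1)"
proof -
  have fin: "finite T" "finite B"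
    using T B finite_subset[OF _ finite_verts] by auto
  have sub: "{w. u \<rightarrow>\<^bsub>G\<^esub> w} \<subseteq> verts G" for u by (auto dest: adj_in_verts)
  have fin_adj: "finite {w. u \<rightarrow>\<^bsub>G\<^esub> w}" for u using sub finite_subset finite_verts by blast
  have top: "out_degree G u \<le> card {w \<in> B. u \<rightarrow>\<^bsub>G\<^esub> w} + (card (verts G) - r - 1)" if u: "u \<in> T" for u
  proof -
    have "{w. u \<rightarrow>\<^bsub>G\<^esub> w} \<subseteq> {w \<in> B. u \<rightarrow>\<^bsub>G\<^esub> w} \<union> (verts G - B - {u})"
      using adj_not_same[of u] by (auto dest: adj_in_verts)
    then have "out_degree G u \<le> card ({w \<in> B. u \<rightarrow>\<^bsub>G\<^esub> w} \<union> (verts G - B - {u}))"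
      unfolding out_degree_eq_card using fin by (intro card_mono) auto
    also have "\<dots> \<le> card {w \<in> B. u \<rightarrow>\<^bsub>G\<^esub> w} + card (verts G - B - {u})"
      by (rule card_Un_le)
    also have "card (verts G - B - {u}) = card (verts G) - r - 1"
      using u assms fin by (subst card_Diff_singleton) (auto simp: card_Diff_subset)
    finally show ?thesis .
  qed
  have "(\<Sum>u\<in>T. out_degree G u)
      \<le> (\<Sum>u\<in>T. card {w \<in> B. u \<rightarrow>\<^bsub>G\<^esub> w} + (card (verts G) - r - 1))"
    by (intro sum_mono top)
  also have "\<dots> = (\<Sum>u\<in>T. card {w \<in> B. u \<rightarrow>\<^bsub>G\<^esub> w}) + r * (card (verts G) - r - 1)"
    by (simp add: sum.distrib T)
  also have "(\<Sum>u\<in>T. card {w \<in> B. u \<rightarrow>\<^bsub>G\<^esub> w}) = (\<Sum>w\<in>B. card {u \<in> T. u \<rightarrow>\<^bsub>G\<^esub> w})"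
    by (rule sum_multicount_gen) (use fin in auto)
  also have "\<dots> \<le> (\<Sum>w\<in>B. out_degree G w)"
  proof (rule sum_mono)
    fix w
    have "{u \<in> T. u \<rightarrow>\<^bsub>G\<^esub> w} \<subseteq> {u. w \<rightarrow>\<^bsub>G\<^esub> u}"
      using sym_arcs by (auto simp: symmetric_def dest: symD)
    then show "card {u \<in> T. u \<rightarrow>\<^bsub>G\<^esub> w} \<le> out_degree G w"
      unfolding out_degree_eq_card by (intro card_mono fin_adj)
  qed
  finally show ?thesis by simp
qed

section \<open>From index pairs to close pairs of vertices\<close>

lemma (in monotone_sequence) pair_weight_le_h:
  assumes p: "bij_betw p {0..<n} (verts G)" and fin: "finite (verts G)"
    and d: "\<And>i. i < n \<Longrightarrow> d i = degree G (p i)"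
  shows "pair_weight 0 n \<le> int (h k G)"
proof -
  define I where "I = (SIGMA i:{0..<n}. {i<..<jump i})"
  have I: "i < n" "j < n" "i < j" "j < jump i" if "(i, j) \<in> I" for i j
    using that jump_le[of i] by (auto simp: I_def)
  have "pair_weight 0 n = (\<Sum>i\<in>{0..<n}. int (card {i<..<jump i}))"
    unfolding pair_weight_def using less_jump by (intro sum.cong) force+
  also have "\<dots> = int (card I)" unfolding I_def by simp
  also have "card I = card ((\<lambda>(i, j). {p i, p j}) ` I)"
  proof (rule card_image[symmetric], rule inj_onI, clarify)
    fix i j i' j' assume ij: "(i, j) \<in> I" "(i', j') \<in> I" and eq: "{p i, p j} = {p i', p j'}"
    have "p ` {i, j} = p ` {i', j'}" using eq by simp
    then have "{i, j} = {i', j'}"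
      using inj_on_image_eq_iff[OF bij_betw_imp_inj_on[OF p], of "{i, j}" "{i', j'}"]
        I[OF ij(1)] I[OF ij(2)] by simp
    then show "i = i' \<and> j = j'" using I(3)[OF ij(1)] I(3)[OF ij(2)] by (auto simp: doubleton_eq_iff)
  qed
  also have "card ((\<lambda>(i, j). {p i, p j}) ` I) \<le> h k G"
    unfolding h_def
  proof (rule card_mono)
    have "close_pairs k G \<subseteq> Pow (verts G)" by (auto simp: close_pairs_def)
    then show "finite (close_pairs k G)" using fin finite_subset by blast
    show "(\<lambda>(i, j). {p i, p j}) ` I \<subseteq> close_pairs k G"
    proof clarify
      fix i j assume ij: "(i, j) \<in> I"
      note * = I[OF ij]
      have "p i \<noteq> p j"
        using inj_onD[OF bij_betw_imp_inj_on[OF p], of i j] * by auto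
      moreover have "p i \<in> verts G" "p j \<in> verts G"
        using bij_betw_imp_surj_on[OF p] * by auto
      moreover have "degree G (p i) \<le> degree G (p j)" "degree G (p j) < degree G (p i) + k"
        using close_if_less_jump[of i j] d_mono[of i j] d * by auto
      then have "\<bar>int (degree G (p i)) - int (degree G (p j))\<bar> < int k" by simp
      ultimately show "{p i, p j} \<in> close_pairs k G"
        unfolding close_pairs_def by blast
    qed
  qed
  finally show ?thesis by simp
qed

lemma of_nat_choose_two: "2 * int (x choose 2) = int x * (int x - 1)"
proof (induction x)
  case (Suc x)
  then show ?case by (simp add: numeral_2_eq_2 algebra_simps)
qed simp

text \<open>Of the two conditions on jumps in \<open>pair_weight_bound\<close>, the first holds as
  degrees are below \<open>n\<close>, the second by \<open>sum_out_degree_gap\<close>.\<close>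

lemma h_ge:
  fixes G :: "('a, 'b) pre_digraph" and k m q :: nat
  assumes "graph G" and k: "0 < k" and q: "0 < q" and m: "m + 1 < k"
    and n: "card (verts G) = q * k + m + 1"
  shows "int q * int k * (int k - 1) + 2 * int k + int m * (int m - 1) \<le> 2 * int (h k G)"
proof -
  interpret graph G by fact
  define n where "n = card (verts G)"
  note n_eq = assms(5)[folded n_def]
  obtain ys where ys: "set ys = verts G" "distinct ys"
    using finite_distinct_list[OF finite_verts] by blast
  define xs where "xs = sort_key (degree G) ys"
  have xs: "set xs = verts G" "distinct xs" "length xs = n" "sorted (map (degree G) xs)"
    using ys distinct_card[of ys] by (simp_all add: xs_def n_def)
  define d where "d i = degree G (xs ! i)" for i
  have p: "bij_betw ((!) xs) {0..<n} (verts G)"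
    using bij_betw_nth[OF xs(2), of "{0..<n}" "verts G"] xs by (simp add: lessThan_atLeast0)
  interpret monotone_sequence n k d
  proof
    show "d i \<le> d j" if "i \<le> j" "j < n" for i j
      using sorted_nth_mono[OF xs(4), of i j] that xs(3) by (simp add: d_def)
  qed (rule k)
  have d_less: "d i < n" if "i < n" for i
    using out_degree_less[of "xs ! i"] nth_mem[of i xs] that xs(1,3) by (simp add: d_def n_def)
  have "(jump ^^ Suc q) 0 = n"
  proof (rule ccontr)
    define u where "u = (jump ^^ Suc q) 0"
    assume "(jump ^^ Suc q) 0 \<noteq> n"
    then have "u < n" using funpow_jump_le[of 0 "Suc q"] by (simp add: u_def)
    then have "d 0 + Suc q * k < n"
      using funpow_jump_far[of "Suc q" 0] d_less[of u] by (simp add: u_def)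
    then show False using n_eq m by simp
  qed
  moreover have "n \<le> (jump ^^ q) m + m"
  proof (rule ccontr)
    define r where "r = m + 1"
    define u where "u = (jump ^^ q) m"
    assume "\<not> n \<le> (jump ^^ q) m + m"
    then have u: "u + r \<le> n" by (simp add: u_def r_def)
    then have far: "d m + q * k \<le> d u"
      using funpow_jump_far[of q m] by (simp add: u_def r_def)
    have "k \<le> q * k" using q by simp
    then have r: "r + r \<le> n" using n_eq m unfolding r_def by linarith
    have img: "(!) xs ` J \<subseteq> verts G" "card ((!) xs ` J) = card J"
      "(\<Sum>x\<in>(!) xs ` J. degree G x) = sum d J" if "J \<subseteq> {0..<n}" for J
    proof -
      have inj: "inj_on ((!) xs) J" using inj_on_subset[OF bij_betw_imp_inj_on[OF p] that] .
      show "(!) xs ` J \<subseteq> verts G" using bij_betw_imp_surj_on[OF p] that by blast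
      show "card ((!) xs ` J) = card J" using inj by (rule card_image)
      show "(\<Sum>x\<in>(!) xs ` J. degree G x) = sum d J" using inj by (simp add: sum.reindex d_def)
    qed
    have "(!) xs ` {n - r..<n} \<inter> (!) xs ` {0..<r} = (!) xs ` ({n - r..<n} \<inter> {0..<r})"
      using r by (intro inj_on_image_Int[OF bij_betw_imp_inj_on[OF p], symmetric]) auto
    also have "{n - r..<n} \<inter> {0..<r} = {}" using r by auto
    finally have disj: "(!) xs ` {n - r..<n} \<inter> (!) xs ` {0..<r} = {}" by simp
    have upper: "sum d {n - r..<n} \<le> sum d {0..<r} + r * (n - r - 1)"
      using sum_out_degree_gap[OF img(1) _ img(1) _ disj, of r] r img(2,3)[of "{n - r..<n}"]
        img(2,3)[of "{0..<r}"] by (simp add: n_def[symmetric])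
    have "sum d {0..<r} \<le> (\<Sum>i\<in>{0..<r}. d m)"
      using r by (intro sum_mono d_mono) (auto simp: r_def)
    moreover have "(\<Sum>i\<in>{n - r..<n}. d m + q * k) \<le> sum d {n - r..<n}"
    proof (rule sum_mono)
      fix i assume "i \<in> {n - r..<n}"
      then have "d u \<le> d i" using u by (intro d_mono) auto
      with far show "d m + q * k \<le> d i" by simp
    qed
    ultimately have "r * (d m + q * k) \<le> r * d m + r * (n - r - 1)"
      using upper r by simp
    then have "r * (q * k) \<le> r * (n - r - 1)" by (simp add: distrib_left)
    \<comment> \<open>Here \<open>n - r - 1\<close> is \<open>q * k - 1\<close>: the vertex left out
      as its own neighbour gives the strict inequality.\<close>
    moreover have "n - r - 1 < q * k" using n_eq \<open>k \<le> q * k\<close> k by (simp add: r_def)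
    ultimately show False unfolding mult_le_cancel1 by (simp add: r_def)
  qed
  moreover have "m \<le> k" using m by simp
  ultimately have "int q * int k * (int k - 1) + 2 * int k + int m * (int m - 1) \<le> 2 * pair_weight 0 n"
    using pair_weight_bound[OF n_eq q] by blast
  also have "\<dots> \<le> 2 * int (h k G)"
    using pair_weight_le_h[OF p finite_verts] by (simp add: d_def)
  finally show ?thesis .
qed

theorem theorem5:
  fixes n k :: nat and G :: "('a, 'b) pre_digraph"
  assumes "0 < k" and "k < n"
    and "real (n mod k) \<ge> 2 * real k / 3"
    and "graph G" and "card (verts G) = n"
  shows "h k G \<ge> f0 n k"
proof -
  define q m where "q = n div k" and "m = n mod k - 1"
  have "0 < real (n mod k)"
    using assms(1,3) by (simp add: order_less_le_trans[of 0 "2 * real k / 3"])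
  then have "0 < n mod k" by simp
  then have n: "n = q * k + m + 1" using div_mult_mod_eq[of n k] unfolding q_def m_def by linarith
  have m: "m + 1 < k" using \<open>0 < n mod k\<close> mod_less_divisor[OF assms(1), of n] by (simp add: m_def)
  have q: "0 < q" using assms(1,2) by (simp add: q_def div_greater_zero_iff)
  have "\<lceil>real n / real k\<rceil> = int q + 1"
  proof (rule ceiling_unique)
    show "real_of_int (int q + 1) - 1 < real n / real k"
      using assms(1) n by (simp add: pos_less_divide_eq flip: of_nat_mult)
    have "n \<le> (q + 1) * k" using n m by simp
    then have "real n \<le> real ((q + 1) * k)" by (simp only: of_nat_le_iff)
    then show "real n / real k \<le> real_of_int (int q + 1)"
      using assms(1) by (simp add: pos_divide_le_eq algebra_simps)
  qed
  then have c: "nat \<lceil>real n / real k\<rceil> = q + 1" by simp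
  have "f0 n k = (q - 1) * (k choose 2) + ((k + 1) choose 2) + (m choose 2)"
  proof -
    have "n - k * (q + 1 - 1) - 1 = m" using n by (simp add: mult.commute)
    then show ?thesis unfolding f0_def Let_def c by simp
  qed
  \<comment> \<open>Doubling removes the division from the binomial coefficients.\<close>
  then have "2 * int (f0 n k) = (int q - 1) * (2 * int (k choose 2)) + 2 * int ((k + 1) choose 2)
      + 2 * int (m choose 2)"
    using q by (simp add: of_nat_diff)
  also have "\<dots> = int q * int k * (int k - 1) + 2 * int k + int m * (int m - 1)"
    unfolding of_nat_choose_two by (simp add: algebra_simps)
  also have "\<dots> \<le> 2 * int (h k G)"
    using h_ge[OF assms(4,1) q m] assms(5) n by simp
  finally show ?thesis by simp
qed

end
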